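(* Every finite dimensional innerproduct hyperspace $V$ over the real hyperfield $\mathbf{R}$ possesses an orthogonal basis.
   Context: A hyperoperation $\#$ on a non-empty set $X$ is a map from $X\times X$ to the set of non-empty subsets of $X$. Hyperoperations are extended to subsets by unions, e.g. $x\#A=\bigcup_{a\in A}x\#a$, $A\#B=\bigcup_{a\in A,b\in B}a\#b$, and $a\ast A=\bigcup_{x\in A}a\ast x$ for $\ast$ below. $(X,\#)$ is a hypergroup if (i) $a\#(b\#c)=(a\#b)\#c$ for all $a,b,c$; (ii) there is $0\in X$ such that for every $a\in X$ there is a unique $b\in X$ with $0\in a\#b$ and $0\in b\#a$ (write $b=-a$); (iii) $a\in b\#c$ implies $b\in a\#(-c)$. It is commutative if $a\#b=b\#a$ for all $a,b$; then $0$ is unique. A hyperring is a set $X$ with a hyperaddition $\#$ and a (single-valued) multiplication $\cdot$ such that $(X,\#)$ is a commutative hypergroup, $(X,\cdot)$ is a semigroup, multiplication distributes over $\#$ on both sides, and $a\cdot 0=0\cdot a=0$ for all $a$. A hyperfield is a hyperring with commutative multiplication, an identity $1$, and such that each non-zero $a$ has an $a^{-1}$ with $a\cdot a^{-1}=1$. Let $(F,\oplus,\cdot)$ be a hyperfield and $(V,\#)$ an (additive) commutative hypergroup with zero vector $\theta$. $V$ is a hypervector space (hyperspace) over $F$ if there is a map $\ast:F\times V\to P^{\ast}(V)$ (non-empty subsets of $V$) such that for all $a,b\in F$, $\alpha,\beta\in V$: (i) $a\ast(\alpha\#\beta)\subseteq a\ast\alpha\,\#\,a\ast\beta$; (ii)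 $(a\oplus b)\ast\alpha\subseteq a\ast\alpha\,\#\,b\ast\alpha$; (iii) $(a\cdot b)\ast\alpha=a\ast(b\ast\alpha)$; (iv) $(-a)\ast\alpha=a\ast(-\alpha)$; (v) $\alpha\in 1_F\ast\alpha$, $\theta\in 0\ast\alpha$ and $0\ast\theta=\theta$ (that is, $\{\theta\}$). A subset $A$ of $V$ is linearly dependent if there are a finite subset $\{\alpha_1,\dots,\alpha_n\}\subseteq A$ and $\lambda_1,\dots,\lambda_n\in F$, not all zero, with $\theta\in\lambda_1\ast\alpha_1\#\cdots\#\lambda_n\ast\alpha_n$; otherwise $A$ is linearly independent. A linearly independent subset $A$ is a basis if for every $\alpha\in V$ there are $n\in\mathbb{N}$, $\lambda_1,\dots,\lambda_n\in F$ and $\alpha_1,\dots,\alpha_n\in A$ with $\alpha\in\lambda_1\ast\alpha_1\#\cdots\#\lambda_n\ast\alpha_n$. $V$ is finite dimensional if it has a finite basis. The real hyperfield $\mathbf{R}$ is the hyperfield defined on the set of all real numbers; its elements (with zero $0$, identity $1$ and additive inverses $-a$) are also treated as ordinary real numbers when multiplied with, or compared to, elements of the usual real line $\mathbb{R}$. An innerproduct on a hypervector space $(V,\#,\ast)$ over the real hyperfield $\mathbf{R}$ is a map $\langle\cdot,\cdot\rangle:V\times V\to\mathbb{R}$ (usual reals) such that for all $\alpha,\beta,\gamma\in V$, $a\in\mathbf{R}$: (i) $\langle\alpha,\alpha\rangle>0$ if $\alpha\ne\theta$; (ii) $\langle\alpha,\alpha\rangle=0$ iff $\alpha=\theta$;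 (iii) $\langle\alpha,\beta\rangle=\langle\beta,\alpha\rangle$; (iv) $\sup\langle\alpha\#\beta,\gamma\rangle=\langle\alpha,\gamma\rangle+\langle\beta,\gamma\rangle$, where $\langle\alpha\#\beta,\gamma\rangle=\{\langle\delta,\gamma\rangle:\delta\in\alpha\#\beta\}$; (v) $\sup\langle a\ast\alpha,\beta\rangle=a\langle\alpha,\beta\rangle$, where $\langle a\ast\alpha,\beta\rangle=\{\langle\delta,\beta\rangle:\delta\in a\ast\alpha\}$. A hypervector space together with an innerproduct is an innerproduct hyperspace. A subset $A$ of $V$ is orthogonal if $\langle\alpha,\beta\rangle=0$ for any two distinct $\alpha,\beta\in A$. An orthogonal subset $A$ of $V$ is an orthogonal basis if for every $\alpha\in V$ there are $n\in\mathbb{N}$, $\lambda_1,\dots,\lambda_n\in\mathbf{R}$ and $\alpha_1,\dots,\alpha_n\in A$ with $\alpha\in\lambda_1\ast\alpha_1\#\cdots\#\lambda_n\ast\alpha_n$. *)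

theory Defs
  imports Complex_Main
begin

definition set_op :: "('a \<Rightarrow> 'b \<Rightarrow> 'c set) \<Rightarrow> 'a set \<Rightarrow> 'b set \<Rightarrow> 'c set"
  where "set_op f A B = (\<Union>a\<in>A. \<Union>b\<in>B. f a b)"

(* Meaningful in a hypergroup, where axiom (ii) makes the described element unique. *)
definition hneg :: "'a set \<Rightarrow> ('a \<Rightarrow> 'a \<Rightarrow> 'a set) \<Rightarrow> 'a \<Rightarrow> 'a \<Rightarrow> 'a"
  where "hneg X add z a = (THE b. b \<in> X \<and> z \<in> add a b \<and> z \<in> add b a)"

(* The zero whose existence axiom (ii) asserts is a parameter; it is unique
   in the commutative case. *)
locale hypergroup =
  fixes X :: "'a set"
    and add :: "'a \<Rightarrow> 'a \<Rightarrow> 'a set" (infixl \<open>\<oplus>\<close> 65)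
    and zero :: 'a (\<open>\<zero>\<close>)
  assumes nonempty: "X \<noteq> {}"
    and add_closed: "\<lbrakk>a \<in> X; b \<in> X\<rbrakk> \<Longrightarrow> a \<oplus> b \<subseteq> X"
    and add_nonempty: "\<lbrakk>a \<in> X; b \<in> X\<rbrakk> \<Longrightarrow> a \<oplus> b \<noteq> {}"
    and add_assoc: "\<lbrakk>a \<in> X; b \<in> X; c \<in> X\<rbrakk>
      \<Longrightarrow> set_op (\<oplus>) {a} (b \<oplus> c) = set_op (\<oplus>) (a \<oplus> b) {c}"
    and zero_closed: "\<zero> \<in> X"
    and ex1_neg: "a \<in> X \<Longrightarrow> \<exists>!b. b \<in> X \<and> \<zero> \<in> a \<oplus> b \<and> \<zero> \<in> b \<oplus> a"
    and reversible: "\<lbrakk>a \<in> X; b \<in> X; c \<in> X; a \<in> b \<oplus> c\<rbrakk>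
      \<Longrightarrow> b \<in> a \<oplus> hneg X (\<oplus>) \<zero> c"

locale comm_hypergroup = hypergroup +
  assumes add_commute: "\<lbrakk>a \<in> X; b \<in> X\<rbrakk> \<Longrightarrow> a \<oplus> b = b \<oplus> a"

locale hyperring = comm_hypergroup +
  fixes mult :: "'a \<Rightarrow> 'a \<Rightarrow> 'a" (infixl \<open>\<odot>\<close> 70)
  assumes mult_closed: "\<lbrakk>a \<in> X; b \<in> X\<rbrakk> \<Longrightarrow> a \<odot> b \<in> X"
    and mult_assoc: "\<lbrakk>a \<in> X; b \<in> X; c \<in> X\<rbrakk> \<Longrightarrow> (a \<odot> b) \<odot> c = a \<odot> (b \<odot> c)"
    and distrib_left: "\<lbrakk>a \<in> X; b \<in> X; c \<in> X\<rbrakk>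
      \<Longrightarrow> (\<lambda>x. a \<odot> x) ` (b \<oplus> c) = (a \<odot> b) \<oplus> (a \<odot> c)"
    and distrib_right: "\<lbrakk>a \<in> X; b \<in> X; c \<in> X\<rbrakk>
      \<Longrightarrow> (\<lambda>x. x \<odot> a) ` (b \<oplus> c) = (b \<odot> a) \<oplus> (c \<odot> a)"
    and mult_zero: "a \<in> X \<Longrightarrow> a \<odot> \<zero> = \<zero>"
    and zero_mult: "a \<in> X \<Longrightarrow> \<zero> \<odot> a = \<zero>"

locale hyperfield = hyperring +
  fixes one :: 'a (\<open>\<one>\<close>)
  assumes mult_commute: "\<lbrakk>a \<in> X; b \<in> X\<rbrakk> \<Longrightarrow> a \<odot> b = b \<odot> a"
    and one_closed: "\<one> \<in> X"
    and one_mult: "a \<in> X \<Longrightarrow> \<one> \<odot> a = a"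
    and ex_inverse: "\<lbrakk>a \<in> X; a \<noteq> \<zero>\<rbrakk> \<Longrightarrow> \<exists>b\<in>X. a \<odot> b = \<one>"

locale hypervector_space =
  F: hyperfield F fadd fzero fmult fone + V: comm_hypergroup V vadd vzero
  for F :: "'f set"
    and fadd :: "'f \<Rightarrow> 'f \<Rightarrow> 'f set" (infixl \<open>\<oplus>\<close> 65)
    and fzero :: 'f (\<open>\<zero>\<close>)
    and fmult :: "'f \<Rightarrow> 'f \<Rightarrow> 'f" (infixl \<open>\<odot>\<close> 70)
    and fone :: 'f (\<open>\<one>\<close>)
    and V :: "'v set"
    and vadd :: "'v \<Rightarrow> 'v \<Rightarrow> 'v set" (infixl \<open>\<boxplus>\<close> 65)
    and vzero :: 'v (\<open>\<theta>\<close>) +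
  fixes smult :: "'f \<Rightarrow> 'v \<Rightarrow> 'v set" (infixr \<open>\<star>\<close> 75)
  assumes smult_closed: "\<lbrakk>a \<in> F; \<alpha> \<in> V\<rbrakk> \<Longrightarrow> a \<star> \<alpha> \<subseteq> V"
    and smult_nonempty: "\<lbrakk>a \<in> F; \<alpha> \<in> V\<rbrakk> \<Longrightarrow> a \<star> \<alpha> \<noteq> {}"
    and smult_vadd: "\<lbrakk>a \<in> F; \<alpha> \<in> V; \<beta> \<in> V\<rbrakk>
      \<Longrightarrow> set_op (\<star>) {a} (\<alpha> \<boxplus> \<beta>) \<subseteq> set_op (\<boxplus>) (a \<star> \<alpha>) (a \<star> \<beta>)"
    and fadd_smult: "\<lbrakk>a \<in> F; b \<in> F; \<alpha> \<in> V\<rbrakk>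
      \<Longrightarrow> set_op (\<star>) (a \<oplus> b) {\<alpha>} \<subseteq> set_op (\<boxplus>) (a \<star> \<alpha>) (b \<star> \<alpha>)"
    and fmult_smult: "\<lbrakk>a \<in> F; b \<in> F; \<alpha> \<in> V\<rbrakk>
      \<Longrightarrow> (a \<odot> b) \<star> \<alpha> = set_op (\<star>) {a} (b \<star> \<alpha>)"
    and neg_smult: "\<lbrakk>a \<in> F; \<alpha> \<in> V\<rbrakk>
      \<Longrightarrow> hneg F (\<oplus>) \<zero> a \<star> \<alpha> = a \<star> hneg V (\<boxplus>) \<theta> \<alpha>"
    and one_smult: "\<alpha> \<in> V \<Longrightarrow> \<alpha> \<in> \<one> \<star> \<alpha>"
    and zero_smult: "\<alpha> \<in> V \<Longrightarrow> \<theta> \<in> \<zero> \<star> \<alpha>"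
    and zero_smult_zero: "\<zero> \<star> \<theta> = {\<theta>}"

(* The empty sum is the zero vector, so the empty set is a basis of the zero
   hyperspace. For n >= 1 the value does not involve z; the bracketing is
   immaterial by associativity. *)
fun hsum :: "('v \<Rightarrow> 'v \<Rightarrow> 'v set) \<Rightarrow> 'v \<Rightarrow> 'v set list \<Rightarrow> 'v set" where
  "hsum add z [] = {z}"
| "hsum add z [A] = A"
| "hsum add z (A # B # As) = set_op add A (hsum add z (B # As))"

definition lincomb ::
  "('v \<Rightarrow> 'v \<Rightarrow> 'v set) \<Rightarrow> 'v \<Rightarrow> ('f \<Rightarrow> 'v \<Rightarrow> 'v set) \<Rightarrow> ('f \<times> 'v) list \<Rightarrow> 'v set"
  where "lincomb vadd \<theta> smult ps = hsum vadd \<theta> (map (\<lambda>(c, \<alpha>). smult c \<alpha>) ps)"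

(* The vectors are listed without repetition: they enumerate a finite subset of A. *)
definition linearly_dependent ::
  "'f set \<Rightarrow> 'f \<Rightarrow> ('v \<Rightarrow> 'v \<Rightarrow> 'v set) \<Rightarrow> 'v \<Rightarrow> ('f \<Rightarrow> 'v \<Rightarrow> 'v set) \<Rightarrow> 'v set \<Rightarrow> bool"
  where "linearly_dependent F fzero vadd \<theta> smult A \<longleftrightarrow>
    (\<exists>ps. set ps \<subseteq> F \<times> A \<and> distinct (map snd ps) \<and> (\<exists>c\<in>fst ` set ps. c \<noteq> fzero)
      \<and> \<theta> \<in> lincomb vadd \<theta> smult ps)"

definition spanning ::
  "'f set \<Rightarrow> 'v set \<Rightarrow> ('v \<Rightarrow> 'v \<Rightarrow> 'v set) \<Rightarrow> 'v \<Rightarrow> ('f \<Rightarrow> 'v \<Rightarrow> 'v set) \<Rightarrow> 'v set \<Rightarrow> bool"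
  where "spanning F V vadd \<theta> smult A \<longleftrightarrow>
    (\<forall>\<alpha>\<in>V. \<exists>ps. set ps \<subseteq> F \<times> A \<and> \<alpha> \<in> lincomb vadd \<theta> smult ps)"

definition is_basis ::
  "'f set \<Rightarrow> 'f \<Rightarrow> 'v set \<Rightarrow> ('v \<Rightarrow> 'v \<Rightarrow> 'v set) \<Rightarrow> 'v \<Rightarrow> ('f \<Rightarrow> 'v \<Rightarrow> 'v set) \<Rightarrow> 'v set \<Rightarrow> bool"
  where "is_basis F fzero V vadd \<theta> smult A \<longleftrightarrow>
    A \<subseteq> V \<and> \<not> linearly_dependent F fzero vadd \<theta> smult A \<and> spanning F V vadd \<theta> smult A"

definition finite_dimensional ::
  "'f set \<Rightarrow> 'f \<Rightarrow> 'v set \<Rightarrow> ('v \<Rightarrow> 'v \<Rightarrow> 'v set) \<Rightarrow> 'v \<Rightarrow> ('f \<Rightarrow> 'v \<Rightarrow> 'v set) \<Rightarrow> bool"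
  where "finite_dimensional F fzero V vadd \<theta> smult \<longleftrightarrow>
    (\<exists>A. finite A \<and> is_basis F fzero V vadd \<theta> smult A)"

(* Hyperaddition and multiplication may be any that make the set of real numbers
   a hyperfield with zero 0, identity 1 and additive inverses -a. *)
locale real_hyperfield = hyperfield UNIV radd 0 rmult 1
  for radd :: "real \<Rightarrow> real \<Rightarrow> real set" and rmult :: "real \<Rightarrow> real \<Rightarrow> real" +
  assumes neg_eq: "hneg UNIV radd 0 a = - a"

(* Boundedness is required because Sup is unspecified on unbounded sets of reals. *)
definition has_sup :: "real set \<Rightarrow> real \<Rightarrow> bool"
  where "has_sup S x \<longleftrightarrow> S \<noteq> {} \<and> bdd_above S \<and> Sup S = x"

locale innerproduct_hyperspace =
  R: real_hyperfield radd rmult +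
  hypervector_space UNIV radd 0 rmult 1 V vadd \<theta> smult
  for radd :: "real \<Rightarrow> real \<Rightarrow> real set"
    and rmult :: "real \<Rightarrow> real \<Rightarrow> real"
    and V :: "'v set"
    and vadd :: "'v \<Rightarrow> 'v \<Rightarrow> 'v set" (infixl \<open>\<boxplus>\<close> 65)
    and \<theta> :: 'v
    and smult :: "real \<Rightarrow> 'v \<Rightarrow> 'v set" (infixr \<open>\<star>\<close> 75) +
  fixes ip :: "'v \<Rightarrow> 'v \<Rightarrow> real"
  assumes ip_pos: "\<lbrakk>\<alpha> \<in> V; \<alpha> \<noteq> \<theta>\<rbrakk> \<Longrightarrow> ip \<alpha> \<alpha> > 0"
    and ip_eq_zero: "\<alpha> \<in> V \<Longrightarrow> ip \<alpha> \<alpha> = 0 \<longleftrightarrow> \<alpha> = \<theta>"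
    and ip_commute: "\<lbrakk>\<alpha> \<in> V; \<beta> \<in> V\<rbrakk> \<Longrightarrow> ip \<alpha> \<beta> = ip \<beta> \<alpha>"
    and ip_vadd: "\<lbrakk>\<alpha> \<in> V; \<beta> \<in> V; \<gamma> \<in> V\<rbrakk>
      \<Longrightarrow> has_sup ((\<lambda>\<delta>. ip \<delta> \<gamma>) ` (\<alpha> \<boxplus> \<beta>)) (ip \<alpha> \<gamma> + ip \<beta> \<gamma>)"
    and ip_smult: "\<lbrakk>\<alpha> \<in> V; \<beta> \<in> V\<rbrakk>
      \<Longrightarrow> has_sup ((\<lambda>\<delta>. ip \<delta> \<beta>) ` (a \<star> \<alpha>)) (a * ip \<alpha> \<beta>)"

definition orthogonal_set :: "'v set \<Rightarrow> ('v \<Rightarrow> 'v \<Rightarrow> real) \<Rightarrow> 'v set \<Rightarrow> bool"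
  where "orthogonal_set V ip A \<longleftrightarrow>
    A \<subseteq> V \<and> (\<forall>\<alpha>\<in>A. \<forall>\<beta>\<in>A. \<alpha> \<noteq> \<beta> \<longrightarrow> ip \<alpha> \<beta> = 0)"

definition orthogonal_basis ::
  "'v set \<Rightarrow> ('v \<Rightarrow> 'v \<Rightarrow> 'v set) \<Rightarrow> 'v \<Rightarrow> (real \<Rightarrow> 'v \<Rightarrow> 'v set) \<Rightarrow> ('v \<Rightarrow> 'v \<Rightarrow> real)
    \<Rightarrow> 'v set \<Rightarrow> bool"
  where "orthogonal_basis V vadd \<theta> smult ip A \<longleftrightarrow>
    orthogonal_set V ip A \<and> spanning UNIV V vadd \<theta> smult A"

end

(* Although the axioms allow both operations to be multivalued, the innerproduct forces them to
   be single valued: applying the supremum axioms also to additive inverses turns the upper bounds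
   into equalities, so every element of x # y pairs with a vector g to <x,g> + <y,g>, every
   element of a * x pairs to a<x,g>, and pairings determine a vector by definiteness. Gram-Schmidt
   then applies to a finite spanning set. *)
theory Submission
  imports Defs
begin

lemma has_sup_upper: "has_sup S x \<Longrightarrow> s \<in> S \<Longrightarrow> s \<le> x"
  by (auto simp: has_sup_def intro: cSup_upper)

lemma has_sup_unique: "has_sup S x \<Longrightarrow> has_sup S y \<Longrightarrow> x = y"
  by (simp add: has_sup_def)

context hypergroup
begin

lemma hneg_closed: "a \<in> X \<Longrightarrow> hneg X add zero a \<in> X"
  and zero_in_add_hneg: "a \<in> X \<Longrightarrow> zero \<in> add a (hneg X add zero a)"
  and zero_in_hneg_add: "a \<in> X \<Longrightarrow> zero \<in> add (hneg X add zero a) a"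
  using theI'[OF ex1_neg, of a] by (simp_all add: hneg_def)

lemma hneg_eqI: "\<lbrakk>a \<in> X; b \<in> X; zero \<in> add a b; zero \<in> add b a\<rbrakk> \<Longrightarrow> hneg X add zero a = b"
  unfolding hneg_def by (intro the1_equality ex1_neg) auto

end

section \<open>Exact pairings from suprema\<close>

context innerproduct_hyperspace
begin

abbreviation vneg :: "'v \<Rightarrow> 'v"
  where "vneg \<equiv> hneg V vadd \<theta>"

text \<open>\<open>rmult\<close> is abstract, so distributivity over 0 in
  \<open>radd 1 (- 1)\<close> is what makes this product an additive inverse of
  \<open>a\<close>.\<close>

lemma rmult_minus_one: "rmult (- 1) a = - a"
proof -
  have "0 \<in> radd 1 (- 1)"
    using R.zero_in_add_hneg[of 1] by (simp add: R.neg_eq)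
  then have "rmult 0 a \<in> radd (rmult 1 a) (rmult (- 1) a)"
    using R.distrib_right[of a 1 "- 1"] by blast
  then have "0 \<in> radd a (rmult (- 1) a)"
    by (simp add: R.zero_mult R.one_mult)
  then have "hneg UNIV radd 0 a = rmult (- 1) a"
    using R.add_commute[of a "rmult (- 1) a"] by (intro R.hneg_eqI) auto
  then show ?thesis
    by (simp add: R.neg_eq)
qed

lemma minus_one_smult: "x \<in> V \<Longrightarrow> (- 1) \<star> x = 1 \<star> vneg x"
  using neg_smult[of 1 x] by (simp add: R.neg_eq)

lemma ip_zero_left: "y \<in> V \<Longrightarrow> ip \<theta> y = 0"
  using ip_smult[of \<theta> y 0] V.zero_closed by (simp add: zero_smult_zero has_sup_def)

text \<open>Scaling x by -1 and its negative by 1 give the same set, so one supremum is computed in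
  two ways.\<close>

lemma ip_vneg: "x \<in> V \<Longrightarrow> y \<in> V \<Longrightarrow> ip (vneg x) y = - ip x y"
  using has_sup_unique[OF ip_smult[of x y "- 1"]] ip_smult[of "vneg x" y 1]
  by (simp add: minus_one_smult V.hneg_closed)

lemma ip_in_vadd:
  assumes "x \<in> V" "y \<in> V" "z \<in> x \<boxplus> y" "g \<in> V"
  shows "ip z g = ip x g + ip y g"
proof -
  have z: "z \<in> V"
    using assms V.add_closed by blast
  have "ip z g \<le> ip x g + ip y g"
    using has_sup_upper[OF ip_vadd] assms by blast
  \<comment> \<open>Reversibility turns the supremum bound for another sum into the opposite
    inequality.\<close>
  moreover have "x \<in> z \<boxplus> vneg y"
    using V.reversible assms z by blast
  then have "ip x g \<le> ip z g + ip (vneg y) g"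
    using has_sup_upper[OF ip_vadd] assms z V.hneg_closed by blast
  ultimately show ?thesis
    using ip_vneg assms by fastforce
qed

lemma ip_in_smult:
  assumes "x \<in> V" "z \<in> a \<star> x" "g \<in> V"
  shows "ip z g = a * ip x g"
proof -
  have z: "z \<in> V"
    using assms smult_closed by blast
  have "ip z g \<le> a * ip x g"
    using has_sup_upper[OF ip_smult] assms by blast
  \<comment> \<open>The reverse inequality is the supremum bound for -z, which lies in (-1) * (a *
    x) = (-a) * x.\<close>
  moreover have "vneg z \<in> (- 1) \<star> z"
    using one_smult V.hneg_closed z minus_one_smult by blast
  then have "vneg z \<in> (- a) \<star> x"
    using fmult_smult[of "- 1" a x] assms by (auto simp: rmult_minus_one set_op_def)
  then have "ip (vneg z) g \<le> - a * ip x g"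
    using has_sup_upper[OF ip_smult] assms by blast
  ultimately show ?thesis
    using ip_vneg z assms by fastforce
qed

text \<open>Any e in x # (-y) satisfies <e,e> = <x,e> - <y,e> = 0, so e = \<theta>. Then x and y are
  both inverses of -y, and inverses are unique.\<close>

lemma eq_if_ip_eq:
  assumes "x \<in> V" "y \<in> V" and eq: "\<And>g. g \<in> V \<Longrightarrow> ip x g = ip y g"
  shows "x = y"
proof -
  have y: "vneg y \<in> V"
    using assms V.hneg_closed by blast
  then obtain e where e: "e \<in> x \<boxplus> vneg y"
    using V.add_nonempty assms by blast
  then have "e \<in> V"
    using V.add_closed assms y by blast
  then have "e = \<theta>"
    using ip_in_vadd[OF _ y e, of e] assms by (simp add: ip_vneg flip: ip_eq_zero)
  then have "\<theta> \<in> x \<boxplus> vneg y" "\<theta> \<in> vneg y \<boxplus> x"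
    using e V.add_commute assms y by auto
  then show ?thesis
    using V.ex1_neg[OF y] V.zero_in_add_hneg V.zero_in_hneg_add assms by blast
qed

text \<open>A sum is non-empty, and all vectors with the pairings of one of its elements coincide
  with that element; membership becomes real arithmetic.\<close>

lemma in_vadd_iff:
  assumes "x \<in> V" "y \<in> V" "z \<in> V"
  shows "z \<in> x \<boxplus> y \<longleftrightarrow> (\<forall>g\<in>V. ip z g = ip x g + ip y g)"
proof -
  obtain w where w: "w \<in> x \<boxplus> y" "w \<in> V"
    using V.add_nonempty[of x y] V.add_closed[of x y] assms by blast
  then have "z = w" if "\<forall>g\<in>V. ip z g = ip x g + ip y g"
    using that assms by (intro eq_if_ip_eq) (auto simp: ip_in_vadd[OF assms(1,2)])
  then show ?thesis
    using w ip_in_vadd[OF assms(1,2)] by blast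
qed

lemma vadd_zero:
  assumes "x \<in> V"
  shows "x \<boxplus> \<theta> = {x}"
proof -
  have "z = x" if "z \<in> x \<boxplus> \<theta>" for z
    using that assms V.zero_closed V.add_closed[of x \<theta>] ip_in_vadd[of x \<theta> z]
    by (intro eq_if_ip_eq) (auto simp: ip_zero_left)
  then show ?thesis
    using V.add_nonempty[OF assms V.zero_closed] by blast
qed

section \<open>Spans and linear combinations\<close>

lemma ex_axpy:
  assumes "x \<in> V" "y \<in> V"
  shows "\<exists>z\<in>V. \<forall>g\<in>V. ip z g = a * ip x g + ip y g"
proof -
  obtain u where u: "u \<in> a \<star> x" "u \<in> V"
    using smult_nonempty[of a x] smult_closed[of a x] assms by blast
  obtain z where "z \<in> u \<boxplus> y" "z \<in> V"
    using V.add_nonempty[of u y] V.add_closed[of u y] assms u by blast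
  then show ?thesis
    using assms u by (intro bexI[of _ z]) (auto simp: ip_in_vadd[of u y z] ip_in_smult[of x u a])
qed

(* The step z = c v + x is expressed by the pairings of z, which determine z; closure properties
   of the span then reduce to real arithmetic. *)
inductive_set hspan :: "'v set \<Rightarrow> 'v set" for A
  where zero: "\<theta> \<in> hspan A"
  | axpy: "\<lbrakk>v \<in> A; x \<in> hspan A; z \<in> V; \<And>g. g \<in> V \<Longrightarrow> ip z g = c * ip v g + ip x g\<rbrakk>
      \<Longrightarrow> z \<in> hspan A"

lemma hspan_closed: "x \<in> hspan A \<Longrightarrow> x \<in> V"
  by (induction rule: hspan.induct) (auto simp: V.zero_closed)

lemma hspan_mono: "x \<in> hspan A \<Longrightarrow> A \<subseteq> B \<Longrightarrow> x \<in> hspan B"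
  by (induction rule: hspan.induct) (auto intro: hspan.intros)

lemma hspan_lincomb_closed:
  assumes "A \<subseteq> V" "x \<in> hspan A" "y \<in> hspan A"
    and "z \<in> V" "\<And>g. g \<in> V \<Longrightarrow> ip z g = c * ip x g + ip y g"
  shows "z \<in> hspan A"
  using assms(2,4,5)
proof (induction arbitrary: z rule: hspan.induct)
  case zero
  then have "z = y"
    using hspan_closed assms by (intro eq_if_ip_eq) (auto simp: ip_zero_left)
  then show ?case
    using assms by simp
next
  case (axpy v x u d)
  \<comment> \<open>With u = d v + x, the target c u + y regroups as (c d) v + (c x + y); w is the
    bracket, to which the induction hypothesis applies.\<close>
  obtain w where w: "w \<in> V" "\<And>g. g \<in> V \<Longrightarrow> ip w g = c * ip x g + ip y g"
    using ex_axpy[OF hspan_closed[OF axpy.hyps(2)] hspan_closed[OF assms(3)]] by blast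
  then have "w \<in> hspan A"
    using axpy.IH by blast
  moreover have "ip z g = c * d * ip v g + ip w g" if "g \<in> V" for g
    using that axpy.hyps axpy.prems w by (simp add: algebra_simps)
  ultimately show ?case
    using axpy.hyps axpy.prems by (intro hspan.axpy[of v A w z "c * d"])
qed

text \<open>Carries spanning over from the given basis to the set built by Gram-Schmidt.\<close>

lemma hspan_subset:
  assumes "B \<subseteq> V" "A \<subseteq> hspan B" "x \<in> hspan A"
  shows "x \<in> hspan B"
  using assms(3)
proof (induction rule: hspan.induct)
  case zero
  show ?case
    by (rule hspan.zero)
next
  case (axpy v x z c)
  then show ?case
    using assms by (intro hspan_lincomb_closed[of B v x z c]) auto
qed

text \<open>\<open>hsum\<close> returns a single summand without adding \<theta>;
  \<open>vadd_zero\<close> reconciles that clause with the uniform recursion.\<close>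

lemma lincomb_Cons:
  assumes "v \<in> V"
  shows "lincomb vadd \<theta> smult ((c, v) # ps)
    = set_op vadd (c \<star> v) (lincomb vadd \<theta> smult ps)"
proof (cases ps)
  case Nil
  have "x \<boxplus> \<theta> = {x}" if "x \<in> c \<star> v" for x
    using that smult_closed assms vadd_zero by blast
  then show ?thesis
    using Nil by (auto simp: lincomb_def set_op_def)
qed (simp add: lincomb_def)

lemma lincomb_hspan:
  assumes "A \<subseteq> V" "set ps \<subseteq> UNIV \<times> A" "z \<in> lincomb vadd \<theta> smult ps"
  shows "z \<in> hspan A"
  using assms(2,3)
proof (induction ps arbitrary: z)
  case Nil
  then show ?case
    by (simp add: lincomb_def hspan.zero)
next
  case (Cons p ps)
  obtain c v where p: "p = (c, v)" "v \<in> A" "v \<in> V"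
    using Cons.prems assms(1) by (cases p) auto
  then obtain u x where u: "u \<in> c \<star> v" "x \<in> hspan A" "z \<in> u \<boxplus> x"
    using Cons lincomb_Cons by (auto simp: set_op_def)
  have "u \<in> V" "x \<in> V"
    using u p smult_closed hspan_closed by blast+
  then show ?case
    using u p V.add_closed[of u x] by (intro hspan.axpy[of v A x z c])
      (auto simp: ip_in_vadd ip_in_smult)
qed

lemma hspan_lincomb:
  assumes "A \<subseteq> V" "z \<in> hspan A"
  shows "\<exists>ps. set ps \<subseteq> UNIV \<times> A \<and> z \<in> lincomb vadd \<theta> smult ps"
  using assms(2)
proof (induction rule: hspan.induct)
  case zero
  show ?case
    by (rule exI[of _ "[]"]) (simp add: lincomb_def)
next
  case (axpy v x z c)
  then obtain ps where ps: "set ps \<subseteq> UNIV \<times> A" "x \<in> lincomb vadd \<theta> smult ps"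
    by blast
  have v: "v \<in> V" "x \<in> V"
    using axpy assms hspan_closed by blast+
  obtain u where u: "u \<in> c \<star> v" "u \<in> V"
    using smult_nonempty[of c v] smult_closed[of c v] v by blast
  \<comment> \<open>Any choice of u in c * v works, since its pairings are determined by c and
    v.\<close>
  then have "z \<in> u \<boxplus> x"
    using axpy v by (auto simp: in_vadd_iff ip_in_smult)
  then have "z \<in> lincomb vadd \<theta> smult ((c, v) # ps)"
    using u v ps by (auto simp: lincomb_Cons set_op_def)
  then show ?case
    using ps axpy by (intro exI[of _ "(c, v) # ps"]) auto
qed

lemma spanning_iff_hspan:
  "A \<subseteq> V \<Longrightarrow> spanning UNIV V vadd \<theta> smult A \<longleftrightarrow> V \<subseteq> hspan A"
  unfolding spanning_def using lincomb_hspan hspan_lincomb by blast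

section \<open>Orthogonal projection and Gram-Schmidt\<close>

text \<open>Adding a multiple of the new vector b to the projection s onto the smaller set leaves
  the earlier pairings intact, because b is orthogonal to that set.\<close>

lemma ex_projection:
  assumes "finite B" "orthogonal_set V ip B" "x \<in> V"
  shows "\<exists>s\<in>hspan B. \<forall>b\<in>B. ip s b = ip x b"
  using assms(1,2)
proof (induction rule: finite_induct)
  case empty
  show ?case
    using hspan.zero by blast
next
  case (insert b B)
  then obtain s where s: "s \<in> hspan B" "\<And>d. d \<in> B \<Longrightarrow> ip s d = ip x d"
    by (auto simp: orthogonal_set_def)
  \<comment> \<open>Solves c <b,b> + <s,b> = <x,b> when b is non-zero.\<close>
  define c where "c = (ip x b - ip s b) / ip b b"
  have b: "b \<in> V" "B \<subseteq> V" "s \<in> V"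
    using insert s hspan_closed by (auto simp: orthogonal_set_def)
  then obtain t where t: "t \<in> V" "\<And>g. g \<in> V \<Longrightarrow> ip t g = c * ip b g + ip s g"
    using ex_axpy[of b s c] by blast
  have "t \<in> hspan (insert b B)"
    using t s hspan_mono[of s B "insert b B"] by (intro hspan.axpy[of b _ s t c]) auto
  moreover have "ip t b = ip x b"
  \<comment> \<open>An orthogonal set may contain \<theta>; division by zero then makes c = 0, and
    both pairings with b vanish.\<close>
  proof (cases "b = \<theta>")
    case True
    then show ?thesis
      using ip_commute[of _ \<theta>] t V.zero_closed assms by (simp add: ip_zero_left)
  next
    case False
    then show ?thesis
      using t b ip_eq_zero by (simp add: c_def)
  qed
  moreover have "ip t d = ip x d" if "d \<in> B" for d
  proof -
    have "ip b d = 0"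
      using insert that by (auto simp: orthogonal_set_def)
    then show ?thesis
      using t s that b by auto
  qed
  ultimately show ?case
    by blast
qed

lemma gram_schmidt:
  assumes "finite A" "A \<subseteq> V"
  shows "\<exists>B. finite B \<and> orthogonal_set V ip B \<and> A \<subseteq> hspan B"
  using assms
proof (induction rule: finite_induct)
  case empty
  show ?case
    by (rule exI[of _ "{}"]) (simp add: orthogonal_set_def)
next
  case (insert x A)
  then obtain B where B: "finite B" "orthogonal_set V ip B" "A \<subseteq> hspan B"
    by auto
  have x: "x \<in> V"
    using insert by simp
  obtain s where s: "s \<in> hspan B" "\<And>b. b \<in> B \<Longrightarrow> ip s b = ip x b"
    using ex_projection[OF B(1,2) x] by blast
  then have sV: "s \<in> V"
    using hspan_closed by blast
  \<comment> \<open>y is the residual x - s; it is \<theta> when x already lies in the span of B,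
    and inserting \<theta> keeps the set orthogonal.\<close>
  then obtain y where y: "y \<in> V" "\<And>g. g \<in> V \<Longrightarrow> ip y g = - 1 * ip s g + ip x g"
    using ex_axpy[OF sV x, of "- 1"] by blast
  have BV: "B \<subseteq> V"
    using B by (simp add: orthogonal_set_def)
  have "ip y b = 0" "ip b y = 0" if "b \<in> B" for b
    using y s that BV ip_commute[of b y] by auto
  then have "orthogonal_set V ip (insert y B)"
    using B y by (auto simp: orthogonal_set_def)
  \<comment> \<open>Recovers x as 1 y + s, with s in the span of B.\<close>
  moreover have "x \<in> hspan (insert y B)"
    using x y s hspan_mono[of s B "insert y B"]
    by (intro hspan.axpy[of y _ s x 1]) auto
  moreover have "A \<subseteq> hspan (insert y B)"
    using B hspan_mono[of _ B "insert y B"] by blast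
  ultimately show ?case
    using B by (intro exI[of _ "insert y B"]) auto
qed

lemma ex_orthogonal_basis:
  assumes "finite_dimensional UNIV 0 V vadd \<theta> smult"
  shows "\<exists>B. orthogonal_basis V vadd \<theta> smult ip B"
proof -
  obtain A where A: "finite A" "A \<subseteq> V" "V \<subseteq> hspan A"
    using assms spanning_iff_hspan by (auto simp: finite_dimensional_def is_basis_def)
  obtain B where B: "orthogonal_set V ip B" "A \<subseteq> hspan B"
    using gram_schmidt[OF A(1,2)] by blast
  have "B \<subseteq> V"
    using B by (simp add: orthogonal_set_def)
  moreover from this have "V \<subseteq> hspan B"
    using hspan_subset B A by blast
  ultimately show ?thesis
    using B spanning_iff_hspan by (auto simp: orthogonal_basis_def)
qed

end

theorem mainTheorem2:
  fixes radd :: "real \<Rightarrow> real \<Rightarrow> real set"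
    and rmult :: "real \<Rightarrow> real \<Rightarrow> real"
    and V :: "'v set"
    and vadd :: "'v \<Rightarrow> 'v \<Rightarrow> 'v set"
    and \<theta> :: 'v
    and smult :: "real \<Rightarrow> 'v \<Rightarrow> 'v set"
    and ip :: "'v \<Rightarrow> 'v \<Rightarrow> real"
  assumes "innerproduct_hyperspace radd rmult V vadd \<theta> smult ip"
    and "finite_dimensional (UNIV :: real set) 0 V vadd \<theta> smult"
  shows "\<exists>A. orthogonal_basis V vadd \<theta> smult ip A"
  using innerproduct_hyperspace.ex_orthogonal_basis[OF assms] .

end
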